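(* Let $\mathcal J=\mathcal L\times\mathcal I$ with $|\mathcal J|=LI$, and let $\mathcal M$ be the set of devices with $|\mathcal M|\ge|\mathcal J|$. For $j=(\ell,i)\in\mathcal J$ put $W_j=W_{\ell,i}$. Relabel the experts by $1,\dots,|\mathcal J|$ and the devices by $1,\dots,|\mathcal M|$ so that $$W_1\ge W_2\ge\cdots\ge W_{|\mathcal J|},\qquad R_1\le R_2\le\cdots\le R_{|\mathcal M|}.$$ Then an optimal solution of the assignment problem $$\min_{\mathbf X}\ \sum_{j\in\mathcal J}\sum_{m\in\mathcal M}x_{j,m}W_jR_m$$ subject to $x_{j,m}\in\{0,1\}$, $\sum_{m\in\mathcal M}x_{j,m}=1$ for all $j\in\mathcal J$, and $\sum_{j\in\mathcal J}x_{j,m}\le1$ for all $m\in\mathcal M$, is given by assigning the $j$-th largest-weight expert to the $j$-th lowest-cost device, i.e. $$x_{j,m}^\star=\begin{cases}1,& m=j,\ j=1,\dots,|\mathcal J|,\\ 0,&\text{otherwise},\end{cases}$$ so that only the first $|\mathcal J|$ devices are used.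
   Context: $\mathcal L=\{1,\dots,L\}$ are layers, $\mathcal I=\{1,\dots,I\}$ experts per layer, $\mathcal M=\{1,\dots,M\}$ devices. $x_{j,m}=x_{\ell,i,m}=1$ means expert $j=(\ell,i)$ is placed on device $m$. The expert weights and device costs are $$W_{\ell,i}=a_\ell c_\ell^2\,\mathbb E\big[\mathbf 1\{i\in S_\ell^{(t)}\}(g_{\ell,i}^{(t)})^2\big]\ge0,\qquad R_m=\mathbb E\Big[\frac{1}{|h_m^{(t)}|^2P_m}\Big]>0,$$ where $a_\ell\ge0$, $c_\ell>0$ are constants, $S_\ell^{(t)}\subseteq\mathcal I$ is a random activated expert set, $g_{\ell,i}^{(t)}\in(0,1)$ are random gating scores, $h_m^{(t)}$ are random nonzero complex channel coefficients, and $P_m>0$ are power budgets. The $R_m$ are assumed finite; only the facts that $W_{\ell,i}$ and $R_m$ are nonnegative real numbers matter for the problem. *)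

theory Defs
  imports "HOL-Probability.Probability_Measure"
begin

text \<open>Experts are pairs (layer, index). The token superscript \<open>t\<close> is suppressed: the random
  variables below are those of one arbitrary token.\<close>

definition expert_weight ::
  "'w measure \<Rightarrow> (nat \<Rightarrow> real) \<Rightarrow> (nat \<Rightarrow> real) \<Rightarrow> (nat \<Rightarrow> 'w \<Rightarrow> nat set) \<Rightarrow>
   (nat \<Rightarrow> nat \<Rightarrow> 'w \<Rightarrow> real) \<Rightarrow> nat \<times> nat \<Rightarrow> real" where
  "expert_weight \<mu> a c S g = (\<lambda>(l, i).
     a l * (c l)\<^sup>2 * (\<integral>\<omega>. indicator (S l \<omega>) i * (g l i \<omega>)\<^sup>2 \<partial>\<mu>))"

definition device_cost ::
  "'w measure \<Rightarrow> (nat \<Rightarrow> 'w \<Rightarrow> complex) \<Rightarrow> (nat \<Rightarrow> real) \<Rightarrow> nat \<Rightarrow> real" where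
  "device_cost \<mu> h P m = (\<integral>\<omega>. 1 / ((cmod (h m \<omega>))\<^sup>2 * P m) \<partial>\<mu>)"

definition feasible_placement :: "'j set \<Rightarrow> 'm set \<Rightarrow> ('j \<Rightarrow> 'm \<Rightarrow> real) \<Rightarrow> bool" where
  "feasible_placement J D X \<longleftrightarrow>
     (\<forall>j\<in>J. \<forall>m\<in>D. X j m \<in> {0, 1}) \<and>
     (\<forall>j\<in>J. (\<Sum>m\<in>D. X j m) = 1) \<and>
     (\<forall>m\<in>D. (\<Sum>j\<in>J. X j m) \<le> 1)"

definition placement_cost ::
  "'j set \<Rightarrow> 'm set \<Rightarrow> ('j \<Rightarrow> real) \<Rightarrow> ('m \<Rightarrow> real) \<Rightarrow> ('j \<Rightarrow> 'm \<Rightarrow> real) \<Rightarrow> real" where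
  "placement_cost J D W R X = (\<Sum>j\<in>J. \<Sum>m\<in>D. X j m * W j * R m)"

text \<open>A relabelling is a map from labels \<open>1, 2, \<dots>\<close> to the original objects: \<open>\<sigma> k\<close> is the
  expert and \<open>\<tau> k\<close> the device that receives label \<open>k\<close>.\<close>

definition sorted_placement ::
  "nat \<Rightarrow> (nat \<Rightarrow> 'j) \<Rightarrow> (nat \<Rightarrow> 'm) \<Rightarrow> 'j \<Rightarrow> 'm \<Rightarrow> real" where
  "sorted_placement n \<sigma> \<tau> j m = (if \<exists>k\<in>{1..n}. j = \<sigma> k \<and> m = \<tau> k then 1 else 0)"

definition used_devices :: "'j set \<Rightarrow> 'm set \<Rightarrow> ('j \<Rightarrow> 'm \<Rightarrow> real) \<Rightarrow> 'm set" where
  "used_devices J D X = {m \<in> D. \<exists>j\<in>J. X j m = 1}"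

text \<open>Sorted relabellings always exist.\<close>

lemma ex_mono_labelling:
  fixes f :: "'a \<Rightarrow> real"
  assumes "finite A"
  shows "\<exists>\<sigma>. bij_betw \<sigma> {1..card A} A \<and> mono_on {1..card A} (\<lambda>k. f (\<sigma> k))"
proof -
  obtain xs where xs: "set xs = A" "distinct xs"
    using finite_distinct_list[OF assms] by blast
  define ys where "ys = sort_key f xs"
  have ys: "set ys = A" "distinct ys" "sorted (map f ys)"
    using xs by (auto simp: ys_def)
  have len: "length ys = card A"
    using ys distinct_card by metis
  have "bij_betw (\<lambda>k. k - 1) {1..card A} {..<length ys}"
    unfolding len by (rule bij_betw_byWitness[where f' = Suc]) auto
  then have "bij_betw ((!) ys \<circ> (\<lambda>k. k - 1)) {1..card A} A"
    using bij_betw_nth[OF ys(2) refl, of A] ys(1) bij_betw_trans by metis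
  moreover have "mono_on {1..card A} (\<lambda>k. f (((!) ys \<circ> (\<lambda>k. k - 1)) k))"
  proof (rule mono_onI)
    fix r s assume "r \<in> {1..card A}" "s \<in> {1..card A}" "r \<le> s"
    then show "f (((!) ys \<circ> (\<lambda>k. k - 1)) r) \<le> f (((!) ys \<circ> (\<lambda>k. k - 1)) s)"
      using sorted_nth_mono[OF ys(3), of "r - 1" "s - 1"] len by auto
  qed
  ultimately show ?thesis by blast
qed

lemma ex_antimono_labelling:
  fixes f :: "'a \<Rightarrow> real"
  assumes "finite A"
  shows "\<exists>\<sigma>. bij_betw \<sigma> {1..card A} A \<and> antimono_on {1..card A} (\<lambda>k. f (\<sigma> k))"
  using ex_mono_labelling[OF assms, of "\<lambda>x. - f x"] by (simp add: monotone_on_def)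

end

theory Submission
  imports Defs
begin

text \<open>The optimality proof is linear programming duality. With the weights extended by zero to
  all device labels, the telescoping dual prices
  \<open>v m = (\<Sum>i\<in>{m..<N}. w i * (r (i + 1) - r i))\<close> satisfy \<open>v k - v m \<le> w k * (r m - r k)\<close>,
  because the weights decrease and the costs increase. Summing this inequality against a feasible
  placement bounds its cost below by \<open>\<Sum>k. w k * r k\<close>, the cost of the sorted placement.\<close>

lemma dual_price_ineq:
  fixes w r :: "nat \<Rightarrow> real"
  assumes w: "antimono_on {1..N} w" and r: "mono_on {1..N} r"
    and k: "k \<in> {1..N}" and m: "m \<in> {1..N}"
  defines "v \<equiv> \<lambda>m. \<Sum>i\<in>{m..<N}. w i * (r (Suc i) - r i)"
  shows "v k - v m \<le> w k * (r m - r k)"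
proof (cases "k \<le> m")
  case True
  have "v k - v m = (\<Sum>i\<in>{k..<m}. w i * (r (Suc i) - r i))"
    unfolding v_def using True m by (simp flip: sum.atLeastLessThan_concat[of k m N])
  \<comment> \<open>Here \<open>i\<close> runs from \<open>k\<close> upwards, so
    \<open>w i \<le> w k\<close>, and the cost increments are nonnegative.\<close>
  also have "\<dots> \<le> (\<Sum>i\<in>{k..<m}. w k * (r (Suc i) - r i))"
    using k m by (intro sum_mono mult_right_mono) (auto intro!: monotone_onD[OF w] monotone_onD[OF r])
  also have "\<dots> = w k * (r m - r k)"
    using True by (simp add: sum_Suc_diff' flip: sum_distrib_left)
  finally show ?thesis .
next
  case False
  have "w k * (r k - r m) = (\<Sum>i\<in>{m..<k}. w k * (r (Suc i) - r i))"
    using False by (simp add: sum_Suc_diff' flip: sum_distrib_left)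
  \<comment> \<open>Now \<open>i\<close> lies before \<open>k\<close>, so
    \<open>w i \<ge> w k\<close>; since both differences also change sign, the same inequality
    results.\<close>
  also have "\<dots> \<le> (\<Sum>i\<in>{m..<k}. w i * (r (Suc i) - r i))"
    using k m by (intro sum_mono mult_right_mono) (auto intro!: monotone_onD[OF w] monotone_onD[OF r])
  also have "\<dots> = v m - v k"
    unfolding v_def using False k by (simp flip: sum.atLeastLessThan_concat[of m k N])
  finally show ?thesis by (simp add: algebra_simps)
qed

text \<open>Weak duality, with row prices \<open>w k * r k + v k\<close> and column prices
  \<open>v m\<close>. As \<open>y\<close> is real and nonnegative, the bound already covers
  fractional assignments.\<close>

lemma sorted_assignment_le:
  fixes w r :: "nat \<Rightarrow> real" and y :: "nat \<Rightarrow> nat \<Rightarrow> real"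
  assumes "n \<le> N"
    and w: "antimono_on {1..n} w" and w0: "\<And>k. k \<in> {1..n} \<Longrightarrow> 0 \<le> w k"
    and r: "mono_on {1..N} r"
    and y0: "\<And>k m. k \<in> {1..n} \<Longrightarrow> m \<in> {1..N} \<Longrightarrow> 0 \<le> y k m"
    and row: "\<And>k. k \<in> {1..n} \<Longrightarrow> (\<Sum>m\<in>{1..N}. y k m) = 1"
    and col: "\<And>m. m \<in> {1..N} \<Longrightarrow> (\<Sum>k\<in>{1..n}. y k m) \<le> 1"
  shows "(\<Sum>k\<in>{1..n}. w k * r k) \<le> (\<Sum>k\<in>{1..n}. \<Sum>m\<in>{1..N}. y k m * w k * r m)"
proof -
  \<comment> \<open>Zero weights pad the rows up to \<open>N\<close>. Because \<open>w\<close> is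
    nonnegative, the padded sequence still decreases, and the prices of the surplus columns become
    0.\<close>
  define w' where "w' k = (if k \<le> n then w k else 0)" for k
  define v where "v m = (\<Sum>i\<in>{m..<N}. w' i * (r (Suc i) - r i))" for m
  have w': "antimono_on {1..N} w'"
    using w w0 by (auto simp: w'_def monotone_on_def)
  have w'0: "0 \<le> w' k" if "k \<in> {1..N}" for k
    using w0 that by (auto simp: w'_def)
  have v0: "0 \<le> v m" if "m \<in> {1..N}" for m
    unfolding v_def using that
    by (intro sum_nonneg mult_nonneg_nonneg) (auto intro!: w'0 monotone_onD[OF r])
  have v_out: "v m = 0" if "m \<in> {1..N} - {1..n}" for m
    unfolding v_def w'_def using that by (intro sum.neutral) auto
  have "(\<Sum>k\<in>{1..n}. \<Sum>m\<in>{1..N}. y k m * v m) = (\<Sum>m\<in>{1..N}. v m * (\<Sum>k\<in>{1..n}. y k m))"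
    by (subst sum.swap) (simp add: sum_distrib_left mult.commute)
  \<comment> \<open>The column bounds are weighted by prices, which \<open>v0\<close> makes
    nonnegative.\<close>
  also have "\<dots> \<le> (\<Sum>m\<in>{1..N}. v m)"
    by (intro sum_mono) (use col v0 in \<open>simp add: mult_left_le\<close>)
  also have "\<dots> = (\<Sum>m\<in>{1..n}. v m)"
    using \<open>n \<le> N\<close> v_out by (intro sum.mono_neutral_right) auto
  finally have price: "(\<Sum>k\<in>{1..n}. \<Sum>m\<in>{1..N}. y k m * v m) \<le> (\<Sum>k\<in>{1..n}. v k)" .
  \<comment> \<open>Each row of \<open>y\<close> sums to 1, so its price can be spread over the
    columns. Keeping \<open>1\<close> unexpanded lets \<open>row\<close> match.\<close>
  have "(\<Sum>k\<in>{1..n}. w k * r k + v k) = (\<Sum>k\<in>{1..n}. \<Sum>m\<in>{1..N}. y k m * (w k * r k + v k))"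
    by (simp add: row del: One_nat_def flip: sum_distrib_right)
  also have "\<dots> \<le> (\<Sum>k\<in>{1..n}. \<Sum>m\<in>{1..N}. y k m * (w k * r m + v m))"
  proof (intro sum_mono mult_left_mono)
    fix k m assume km: "k \<in> {1..n}" "m \<in> {1..N}"
    then show "w k * r k + v k \<le> w k * r m + v m"
      using dual_price_ineq[OF w' r, of k m] \<open>n \<le> N\<close>
      by (simp add: v_def w'_def algebra_simps)
  qed (use y0 in auto)
  also have "\<dots> = (\<Sum>k\<in>{1..n}. \<Sum>m\<in>{1..N}. y k m * w k * r m) + (\<Sum>k\<in>{1..n}. \<Sum>m\<in>{1..N}. y k m * v m)"
    by (simp add: sum.distrib distrib_left mult.assoc)
  finally show ?thesis
    using price by (simp add: sum.distrib)
qed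

context
  fixes n N :: nat and J :: "'j set" and D :: "'m set" and \<sigma> :: "nat \<Rightarrow> 'j" and \<tau> :: "nat \<Rightarrow> 'm"
  assumes nN: "n \<le> N" and \<sigma>: "bij_betw \<sigma> {1..n} J" and \<tau>: "bij_betw \<tau> {1..N} D"
begin

lemma sum_labels_J: "(\<Sum>j\<in>J. f j) = (\<Sum>k\<in>{1..n}. f (\<sigma> k))" for f :: "'j \<Rightarrow> real"
  using sum.reindex_bij_betw[OF \<sigma>, of f] by simp

lemma sum_labels_D: "(\<Sum>m\<in>D. f m) = (\<Sum>k\<in>{1..N}. f (\<tau> k))" for f :: "'m \<Rightarrow> real"
  using sum.reindex_bij_betw[OF \<tau>, of f] by simp

text \<open>Injectivity of \<open>\<sigma>\<close> and \<open>\<tau>\<close> makes the label in the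
  definition unique; \<open>n \<le> N\<close> puts that label in the range where
  \<open>\<tau>\<close> is injective.\<close>

lemma sorted_placement_labels:
  assumes "k \<in> {1..n}" "m \<in> {1..N}"
  shows "sorted_placement n \<sigma> \<tau> (\<sigma> k) (\<tau> m) = (if k = m then 1 else 0)"
proof -
  have "(\<exists>i\<in>{1..n}. \<sigma> k = \<sigma> i \<and> \<tau> m = \<tau> i) \<longleftrightarrow> k = m"
    using assms nN inj_onD[OF bij_betw_imp_inj_on[OF \<sigma>], of k]
      inj_onD[OF bij_betw_imp_inj_on[OF \<tau>], of m] by fastforce
  then show ?thesis by (simp add: sorted_placement_def)
qed

lemma placement_cost_labels:
  "placement_cost J D W R X = (\<Sum>k\<in>{1..n}. \<Sum>m\<in>{1..N}. X (\<sigma> k) (\<tau> m) * W (\<sigma> k) * R (\<tau> m))"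
  by (simp add: placement_cost_def sum_labels_J sum_labels_D)

text \<open>With \<open>placement_cost_labels\<close>, this moves the problem to the matrix
  \<open>X (\<sigma> k) (\<tau> m)\<close>, to which \<open>sorted_assignment_le\<close>
  applies.\<close>

lemma feasible_placement_labels:
  "feasible_placement J D X \<longleftrightarrow>
     (\<forall>k\<in>{1..n}. \<forall>m\<in>{1..N}. X (\<sigma> k) (\<tau> m) \<in> {0, 1}) \<and>
     (\<forall>k\<in>{1..n}. (\<Sum>m\<in>{1..N}. X (\<sigma> k) (\<tau> m)) = 1) \<and>
     (\<forall>m\<in>{1..N}. (\<Sum>k\<in>{1..n}. X (\<sigma> k) (\<tau> m)) \<le> 1)"
proof -
  have "(\<forall>j\<in>J. Q j) \<longleftrightarrow> (\<forall>k\<in>{1..n}. Q (\<sigma> k))" for Q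
    unfolding bij_betw_imp_surj_on[OF \<sigma>, symmetric] by blast
  moreover have "(\<forall>m\<in>D. Q m) \<longleftrightarrow> (\<forall>m\<in>{1..N}. Q (\<tau> m))" for Q
    unfolding bij_betw_imp_surj_on[OF \<tau>, symmetric] by blast
  ultimately show ?thesis
    by (simp add: feasible_placement_def sum_labels_J sum_labels_D)
qed

lemma feasible_sorted_placement: "feasible_placement J D (sorted_placement n \<sigma> \<tau>)"
proof -
  have "(\<Sum>m\<in>{1..N}. sorted_placement n \<sigma> \<tau> (\<sigma> k) (\<tau> m)) = 1" if k: "k \<in> {1..n}" for k
  proof -
    have "(\<Sum>m\<in>{1..N}. sorted_placement n \<sigma> \<tau> (\<sigma> k) (\<tau> m)) = (\<Sum>m\<in>{1..N}. if k = m then 1 else 0)"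
      by (rule sum.cong[OF refl]) (rule sorted_placement_labels[OF k])
    \<comment> \<open>Since \<open>k \<le> n \<le> N\<close>, the diagonal entry of row
      \<open>k\<close> is among the summands.\<close>
    then show ?thesis using k nN by simp
  qed
  moreover have "(\<Sum>k\<in>{1..n}. sorted_placement n \<sigma> \<tau> (\<sigma> k) (\<tau> m)) \<le> 1" if m: "m \<in> {1..N}" for m
  proof -
    have "(\<Sum>k\<in>{1..n}. sorted_placement n \<sigma> \<tau> (\<sigma> k) (\<tau> m)) = (\<Sum>k\<in>{1..n}. if k = m then 1 else 0)"
      by (rule sum.cong[OF refl]) (rule sorted_placement_labels[OF _ m])
    \<comment> \<open>The sum is 1 for \<open>m \<le> n\<close> and 0 for the surplus
      devices.\<close>
    then show ?thesis by simp
  qed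
  ultimately show ?thesis
    by (simp add: feasible_placement_labels sorted_placement_labels)
qed

lemma cost_sorted_placement:
  "placement_cost J D W R (sorted_placement n \<sigma> \<tau>) = (\<Sum>k\<in>{1..n}. W (\<sigma> k) * R (\<tau> k))"
proof -
  have "(\<Sum>m\<in>{1..N}. sorted_placement n \<sigma> \<tau> (\<sigma> k) (\<tau> m) * W (\<sigma> k) * R (\<tau> m))
      = W (\<sigma> k) * R (\<tau> k)" if k: "k \<in> {1..n}" for k
  proof -
    have "(\<Sum>m\<in>{1..N}. sorted_placement n \<sigma> \<tau> (\<sigma> k) (\<tau> m) * W (\<sigma> k) * R (\<tau> m))
        = (\<Sum>m\<in>{1..N}. if k = m then W (\<sigma> k) * R (\<tau> m) else 0)"
      by (rule sum.cong[OF refl]) (simp add: sorted_placement_labels[OF k])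
    then show ?thesis using k nN by simp
  qed
  then show ?thesis by (simp add: placement_cost_labels)
qed

lemma sorted_placement_optimal:
  assumes W0: "\<And>j. j \<in> J \<Longrightarrow> 0 \<le> W j"
    and W: "antimono_on {1..n} (\<lambda>k. W (\<sigma> k))" and R: "mono_on {1..N} (\<lambda>k. R (\<tau> k))"
  shows "is_arg_min (placement_cost J D W R) (feasible_placement J D) (sorted_placement n \<sigma> \<tau>)"
proof -
  have "placement_cost J D W R (sorted_placement n \<sigma> \<tau>) \<le> placement_cost J D W R X"
    if "feasible_placement J D X" for X
    \<comment> \<open>The order matters: \<open>placement_cost_labels\<close> would also rewrite the
      cost of the sorted placement, which must first take its closed form.\<close>
    unfolding cost_sorted_placement unfolding placement_cost_labels
  proof (rule sorted_assignment_le[OF nN W _ R])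
    note X = \<open>feasible_placement J D X\<close>[unfolded feasible_placement_labels]
    show "0 \<le> W (\<sigma> k)" if "k \<in> {1..n}" for k
      using W0 bij_betwE[OF \<sigma>] that by blast
    show "0 \<le> X (\<sigma> k) (\<tau> m)" if "k \<in> {1..n}" "m \<in> {1..N}" for k m
    proof -
      have "X (\<sigma> k) (\<tau> m) \<in> {0, 1}" using X that by blast
      then show ?thesis by auto
    qed
    show "(\<Sum>m\<in>{1..N}. X (\<sigma> k) (\<tau> m)) = 1" if "k \<in> {1..n}" for k
      using X that by blast
    show "(\<Sum>k\<in>{1..n}. X (\<sigma> k) (\<tau> m)) \<le> 1" if "m \<in> {1..N}" for m
      using X that by blast
  qed
  then show ?thesis
    using feasible_sorted_placement by (auto simp: is_arg_min_def not_less)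
qed

lemma used_devices_sorted_placement:
  "used_devices J D (sorted_placement n \<sigma> \<tau>) = \<tau> ` {1..n}"
proof -
  have "sorted_placement n \<sigma> \<tau> j m = 1 \<longleftrightarrow> (\<exists>k\<in>{1..n}. j = \<sigma> k \<and> m = \<tau> k)" for j m
    by (simp add: sorted_placement_def)
  moreover have "\<sigma> k \<in> J" "\<tau> k \<in> D" if "k \<in> {1..n}" for k
    using that nN bij_betwE[OF \<sigma>] bij_betwE[OF \<tau>] by auto
  ultimately show ?thesis
    unfolding used_devices_def by blast
qed

end

text \<open>The integrand is an indicator times a square. A nonintegrable integrand is covered too,
  its Bochner integral being 0 by convention.\<close>

lemma expert_weight_nonneg: "0 \<le> a l \<Longrightarrow> 0 \<le> expert_weight \<mu> a c S g (l, i)"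
  unfolding expert_weight_def prod.case
  by (intro mult_nonneg_nonneg Bochner_Integration.integral_nonneg) auto

theorem theorem2:
  fixes L I M :: nat
    and \<mu> :: "'w measure"
    and a c :: "nat \<Rightarrow> real"
    and S :: "nat \<Rightarrow> 'w \<Rightarrow> nat set"
    and g :: "nat \<Rightarrow> nat \<Rightarrow> 'w \<Rightarrow> real"
    and h :: "nat \<Rightarrow> 'w \<Rightarrow> complex"
    and P :: "nat \<Rightarrow> real"
    and J :: "(nat \<times> nat) set" and D :: "nat set"
    and W :: "nat \<times> nat \<Rightarrow> real" and R :: "nat \<Rightarrow> real"
    and \<sigma> :: "nat \<Rightarrow> nat \<times> nat" and \<tau> :: "nat \<Rightarrow> nat"
  assumes "prob_space \<mu>"
    and "\<And>l. l \<in> {1..L} \<Longrightarrow> a l \<ge> 0"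
    and "\<And>l. l \<in> {1..L} \<Longrightarrow> c l > 0"
    and "\<And>l. l \<in> {1..L} \<Longrightarrow> S l \<in> measurable \<mu> (count_space (Pow {1..I}))"
    and "\<And>l i. l \<in> {1..L} \<Longrightarrow> i \<in> {1..I} \<Longrightarrow> g l i \<in> borel_measurable \<mu>"
    and "\<And>l i \<omega>. l \<in> {1..L} \<Longrightarrow> i \<in> {1..I} \<Longrightarrow> \<omega> \<in> space \<mu> \<Longrightarrow> g l i \<omega> \<in> {0<..<1}"
    and "\<And>m. m \<in> {1..M} \<Longrightarrow> h m \<in> borel_measurable \<mu>"
    and "\<And>m \<omega>. m \<in> {1..M} \<Longrightarrow> \<omega> \<in> space \<mu> \<Longrightarrow> h m \<omega> \<noteq> 0"
    and "\<And>m. m \<in> {1..M} \<Longrightarrow> P m > 0"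
    and "\<And>m. m \<in> {1..M} \<Longrightarrow> integrable \<mu> (\<lambda>\<omega>. 1 / ((cmod (h m \<omega>))\<^sup>2 * P m))"
    and J_def: "J = {1..L} \<times> {1..I}" and D_def: "D = {1..M}"
    and W_def: "W = expert_weight \<mu> a c S g" and R_def: "R = device_cost \<mu> h P"
    and "card D \<ge> card J"
    and "bij_betw \<sigma> {1..card J} J" and "antimono_on {1..card J} (\<lambda>k. W (\<sigma> k))"
    and "bij_betw \<tau> {1..card D} D" and "mono_on {1..card D} (\<lambda>k. R (\<tau> k))"
  shows "is_arg_min (placement_cost J D W R) (feasible_placement J D)
           (sorted_placement (card J) \<sigma> \<tau>) \<and>
         used_devices J D (sorted_placement (card J) \<sigma> \<tau>) = \<tau> ` {1..card J}"
proof -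
  \<comment> \<open>The padding by zero in \<open>sorted_assignment_le\<close> rests on this sign,
    which comes from \<open>a l \<ge> 0\<close>.\<close>
  have "0 \<le> W j" if "j \<in> J" for j
    using that assms(2) unfolding J_def W_def by (auto intro: expert_weight_nonneg)
  then show ?thesis
    using assms(15-19) sorted_placement_optimal used_devices_sorted_placement by blast
qed

end
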